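(* Let $\mu_1$ denote the two-variable Möbius function of the floor quotient poset. Then: (a) For any positive integer $n$ and any integer $k$ with $1 \le k \le \sqrt{n}$, $$\mu_1\left( \left\lfloor \frac{n}{k} \right\rfloor, n \right) = \mu(k),$$ where $\mu(\cdot)$ is the classical Möbius function. (b) For positive integers $d,n$ with $d \ge \sqrt{n}$, we have $|\mu_1(d,n)| \le 1$.
   Context: $\mathbb{N}^+ = \{1,2,3,\ldots\}$. For positive integers $d,n$, $d$ is a floor quotient of $n$, written $d \preccurlyeq_1 n$, if $d = \lfloor n/k \rfloor$ for some positive integer $k$; this relation is a partial order on $\mathbb{N}^+$. Its two-variable Möbius function $\mu_1 : \mathbb{N}^+ \times \mathbb{N}^+ \to \mathbb{Z}$ is the unique function with $\mu_1(n,n)=1$ for all $n$, $\mu_1(d,n)=0$ if $d \not\preccurlyeq_1 n$, and $\sum_{m:\, d \preccurlyeq_1 m \preccurlyeq_1 n} \mu_1(d,m) = 0$ for all $d \ne n$. The classical Möbius function is $\mu(n) = (-1)^r$ if $n$ is a product of $r$ distinct primes and $\mu(n) = 0$ if $n$ is not squarefree. *)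

theory Defs
  imports Complex_Main "HOL-Computational_Algebra.Squarefree"
begin

text \<open>
  The positive integers are rendered as the positive elements of \<^typ>\<open>nat\<close>.
  On naturals, \<open>n div k\<close> is the floor of \<open>n / k\<close>, see \<open>div_eq_floor\<close> below.
\<close>

definition floor_quotient :: "nat \<Rightarrow> nat \<Rightarrow> bool"  (infix \<open>\<preceq>\<^sub>1\<close> 50) where
  "d \<preceq>\<^sub>1 n \<longleftrightarrow> d > 0 \<and> n > 0 \<and> (\<exists>k>0. d = n div k)"

lemma div_eq_floor: "int (n div k) = \<lfloor>real n / real k\<rfloor>"
  by (simp add: floor_divide_of_nat_eq)

lemma floor_quotient_le: "d \<preceq>\<^sub>1 n \<Longrightarrow> d \<le> n"
  by (auto simp: floor_quotient_def)

lemma floor_quotient_refl: "n > 0 \<Longrightarrow> n \<preceq>\<^sub>1 n"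
  unfolding floor_quotient_def by (auto intro!: exI[of _ 1])

lemma floor_quotient_antisym: "d \<preceq>\<^sub>1 n \<Longrightarrow> n \<preceq>\<^sub>1 d \<Longrightarrow> d = n"
  by (meson floor_quotient_le le_antisym)

lemma floor_quotient_trans: "d \<preceq>\<^sub>1 m \<Longrightarrow> m \<preceq>\<^sub>1 n \<Longrightarrow> d \<preceq>\<^sub>1 n"
  unfolding floor_quotient_def
proof (elim conjE exE)
  fix k l assume "0 < d" "0 < n" "0 < k" "0 < l" "d = m div k" "m = n div l"
  then show "0 < d \<and> 0 < n \<and> (\<exists>j>0. d = n div j)"
    by (intro conjI exI[of _ "l * k"]) (auto simp: div_mult2_eq)
qed

text \<open>
  The first conjunct only normalises the junk values off the positive integers, so that
  the function is unique on the whole of \<^typ>\<open>nat\<close>; the other three are the defining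
  conditions of the two-variable Moebius function. The index set of the sum is
  finite by \<open>floor_quotient_le\<close>.
\<close>

definition is_moebius1 :: "(nat \<Rightarrow> nat \<Rightarrow> int) \<Rightarrow> bool" where
  "is_moebius1 f \<longleftrightarrow>
     (\<forall>d n. d = 0 \<or> n = 0 \<longrightarrow> f d n = 0) \<and>
     (\<forall>n>0. f n n = 1) \<and>
     (\<forall>d>0. \<forall>n>0. \<not> d \<preceq>\<^sub>1 n \<longrightarrow> f d n = 0) \<and>
     (\<forall>d>0. \<forall>n>0. d \<noteq> n \<longrightarrow> (\<Sum>m | d \<preceq>\<^sub>1 m \<and> m \<preceq>\<^sub>1 n. f d m) = 0)"

definition moebius1 :: "nat \<Rightarrow> nat \<Rightarrow> int"  (\<open>\<mu>\<^sub>1\<close>) where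
  "\<mu>\<^sub>1 = (THE f. is_moebius1 f)"

lemma floor_quotient_interval_finite: "finite {m. d \<preceq>\<^sub>1 m \<and> m \<preceq>\<^sub>1 n}"
  by (rule finite_subset[of _ "{..n}"]) (auto dest: floor_quotient_le)

lemma floor_quotient_sum_split:
  fixes f :: "nat \<Rightarrow> int"
  assumes "d \<preceq>\<^sub>1 n"
  shows "(\<Sum>m | d \<preceq>\<^sub>1 m \<and> m \<preceq>\<^sub>1 n. f m) =
         f n + (\<Sum>m | d \<preceq>\<^sub>1 m \<and> m \<preceq>\<^sub>1 n \<and> m < n. f m)"
proof -
  have "n > 0" using assms by (simp add: floor_quotient_def)
  then have "{m. d \<preceq>\<^sub>1 m \<and> m \<preceq>\<^sub>1 n} = insert n {m. d \<preceq>\<^sub>1 m \<and> m \<preceq>\<^sub>1 n \<and> m < n}"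
    using assms floor_quotient_refl[of n]
    by (auto dest: floor_quotient_le intro: le_neq_implies_less)
  moreover have "finite {m. d \<preceq>\<^sub>1 m \<and> m \<preceq>\<^sub>1 n \<and> m < n}"
    by (rule finite_subset[OF _ floor_quotient_interval_finite[of d n]]) auto
  ultimately show ?thesis by simp
qed

function moebius1_rec :: "nat \<Rightarrow> nat \<Rightarrow> int" where
  "moebius1_rec d n =
     (if \<not> d \<preceq>\<^sub>1 n then 0 else if d = n then 1
      else - (\<Sum>m | d \<preceq>\<^sub>1 m \<and> m \<preceq>\<^sub>1 n \<and> m < n. moebius1_rec d m))"
  by pat_completeness auto
termination by (relation "measure snd") auto

declare moebius1_rec.simps [simp del]

lemma is_moebius1_rec: "is_moebius1 moebius1_rec"
  unfolding is_moebius1_def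
proof (intro conjI allI impI)
  fix d n :: nat assume "d = 0 \<or> n = 0"
  then show "moebius1_rec d n = 0"
    by (subst moebius1_rec.simps) (auto simp: floor_quotient_def)
next
  fix n :: nat assume "n > 0"
  then show "moebius1_rec n n = 1"
    by (subst moebius1_rec.simps) (simp add: floor_quotient_refl)
next
  fix d n :: nat assume "\<not> d \<preceq>\<^sub>1 n"
  then show "moebius1_rec d n = 0" by (subst moebius1_rec.simps) simp
next
  fix d n :: nat assume ne: "d \<noteq> n"
  show "(\<Sum>m | d \<preceq>\<^sub>1 m \<and> m \<preceq>\<^sub>1 n. moebius1_rec d m) = 0"
  proof (cases "d \<preceq>\<^sub>1 n")
    case True
    then show ?thesis
      using ne by (simp add: floor_quotient_sum_split moebius1_rec.simps[of d n])
  next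
    case False
    then have "{m. d \<preceq>\<^sub>1 m \<and> m \<preceq>\<^sub>1 n} = {}" using floor_quotient_trans by blast
    then show ?thesis by (simp only: sum.empty)
  qed
qed

lemma is_moebius1_unique:
  assumes f: "is_moebius1 f" and g: "is_moebius1 g"
  shows "f = g"
proof (intro ext)
  fix d n
  show "f d n = g d n"
  proof (induction n rule: less_induct)
    case (less n)
    consider "d = 0 \<or> n = 0" | "d > 0" "n > 0" "\<not> d \<preceq>\<^sub>1 n" | "d > 0" "d = n"
      | "d > 0" "n > 0" "d \<preceq>\<^sub>1 n" "d \<noteq> n" by auto
    then show ?case
    proof cases
      case 1 then show ?thesis using f g unfolding is_moebius1_def by metis
    next
      case 2 then show ?thesis using f g unfolding is_moebius1_def by metis
    next
      case 3 then show ?thesis using f g unfolding is_moebius1_def by metis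
    next
      case 4
      have eq: "(\<Sum>m | d \<preceq>\<^sub>1 m \<and> m \<preceq>\<^sub>1 n \<and> m < n. f d m)
          = (\<Sum>m | d \<preceq>\<^sub>1 m \<and> m \<preceq>\<^sub>1 n \<and> m < n. g d m)"
        by (rule sum.cong) (auto simp: less.IH)
      have "(\<Sum>m | d \<preceq>\<^sub>1 m \<and> m \<preceq>\<^sub>1 n. f d m) = 0"
        "(\<Sum>m | d \<preceq>\<^sub>1 m \<and> m \<preceq>\<^sub>1 n. g d m) = 0"
        using f g 4 unfolding is_moebius1_def by simp_all
      then show ?thesis
        using eq unfolding floor_quotient_sum_split[OF 4(3)] by linarith
    qed
  qed
qed

lemma moebius1_eq_rec: "\<mu>\<^sub>1 = moebius1_rec"
  unfolding moebius1_def using is_moebius1_rec is_moebius1_unique by blast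

lemma is_moebius1_moebius1: "is_moebius1 \<mu>\<^sub>1"
  by (simp add: moebius1_eq_rec is_moebius1_rec)

definition moebius_mu :: "nat \<Rightarrow> int"  (\<open>\<mu>\<close>) where
  "\<mu> n = (if squarefree n then (-1) ^ card (prime_factors n) else 0)"

end

theory Submission
  imports Defs
begin

text \<open>
  For \<open>k\<^sup>2 \<le> n\<close> the value \<open>n div k\<close> is at least \<open>k\<close>, and so the quotients \<open>n div j\<close> strictly
  decrease when \<open>j\<close> passes \<open>k\<close>: the index \<open>k\<close> is determined by \<open>n div k\<close>
  (\<open>div_eq_div_imp_eq\<close>). As \<open>(n div l) div j = n div (l * j)\<close>, the interval of the floor quotient
  order between \<open>n div k\<close> and \<open>n\<close> is therefore a copy of the lattice of divisors \<open>l\<close> of \<open>k\<close>, via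
  \<open>l \<mapsto> n div l\<close> (\<open>floor_quotient_interval_eq\<close>). Hence \<open>\<mu>\<^sub>1 (n div k) n\<close> obeys the
  divisor recursion \<open>(\<Sum>l | l dvd k. \<mu> l) = 0\<close>, valid for \<open>k > 1\<close>
  (\<open>sum_moebius_mu_divisors_eq_0\<close>), that characterises the classical function; this is (a).

  For (b), a floor quotient \<open>d = n div k\<close> with \<open>d\<^sup>2 \<ge> n\<close> satisfies \<open>k * d \<le> n \<le> d\<^sup>2\<close>, so that
  \<open>k \<le> d\<close> and \<open>k\<^sup>2 \<le> n\<close>. Part (a) then gives \<open>\<mu>\<^sub>1 d n = \<mu> k\<close>, which lies in \<open>{-1, 0, 1}\<close>.
\<close>

lemma abs_moebius_mu_le_1: "\<bar>\<mu> n\<bar> \<le> 1"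
  by (simp add: moebius_mu_def power_abs)

lemma moebius_mu_1: "\<mu> 1 = 1"
  by (simp add: moebius_mu_def)

lemma squarefree_prime_mult_iff:
  fixes p e :: nat
  assumes "prime p" "\<not> p dvd e"
  shows "squarefree (p * e) \<longleftrightarrow> squarefree e"
proof -
  have "coprime p e" using assms by (simp add: prime_imp_coprime)
  then show ?thesis using assms
    by (auto simp: squarefree_mult_coprime squarefree_prime dest: squarefree_multD)
qed

lemma moebius_mu_prime_mult:
  assumes "prime p" "\<not> p dvd e"
  shows "\<mu> (p * e) = - \<mu> e"
proof -
  have "e \<noteq> 0" using assms(2) dvd_0_right[of p] by metis
  then have "prime_factors (p * e) = insert p (prime_factors e)"
    using assms by (simp add: prime_factors_product prime_factorization_prime)
  moreover have "p \<notin> prime_factors e" using assms(2) by auto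
  ultimately show ?thesis
    using assms by (simp add: moebius_mu_def squarefree_prime_mult_iff)
qed

text \<open>
  Fix a prime \<open>p\<close> dividing \<open>n\<close>. Multiplication by \<open>p\<close> matches the squarefree divisors of \<open>n\<close>
  prime to \<open>p\<close> with those divisible by \<open>p\<close>, and changes the sign of \<open>\<mu>\<close>, so the sum cancels
  in pairs.
\<close>

lemma sum_moebius_mu_divisors_eq_0:
  assumes "n > 1"
  shows "(\<Sum>e | e dvd n. \<mu> e) = 0"
proof -
  obtain p where p: "prime p" "p dvd n" using assms prime_factor_nat[of n] by auto
  define A where "A = {e. e dvd n \<and> squarefree e \<and> \<not> p dvd e}"
  define B where "B = {e. e dvd n \<and> squarefree e \<and> p dvd e}"
  have fin: "finite {e. e dvd n}" using assms by simp
  have finAB: "finite A" "finite B"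
    unfolding A_def B_def by (auto intro: finite_subset[OF _ fin])
  have "B = (*) p ` A"
  proof (intro set_eqI iffI)
    fix e assume e: "e \<in> B"
    then obtain f where f: "e = p * f" unfolding B_def by blast
    have "\<not> p dvd f"
    proof
      assume "p dvd f"
      then have "p\<^sup>2 dvd e" by (simp add: f power2_eq_square)
      then have "is_unit p" using e unfolding B_def squarefree_def by blast
      then show False using p(1) by (simp add: not_prime_unit)
    qed
    then have "f \<in> A"
      using e f p(1) unfolding A_def B_def
      by (auto simp: squarefree_prime_mult_iff intro: dvd_mult_right)
    then show "e \<in> (*) p ` A" using f by blast
  next
    fix e assume "e \<in> (*) p ` A"
    then obtain f where f: "e = p * f" "f \<in> A" by blast
    then have "coprime p f" using p(1) unfolding A_def by (simp add: prime_imp_coprime)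
    then show "e \<in> B"
      using f p unfolding A_def B_def by (auto simp: squarefree_prime_mult_iff divides_mult)
  qed
  moreover have "inj_on ((*) p) A" using p(1) by (auto simp: inj_on_def)
  ultimately have "sum \<mu> B = (\<Sum>e\<in>A. \<mu> (p * e))" by (simp add: sum.reindex)
  also have "\<dots> = - sum \<mu> A"
    unfolding sum_negf[symmetric]
    by (rule sum.cong) (auto simp: A_def moebius_mu_prime_mult p(1))
  finally have "sum \<mu> A + sum \<mu> B = 0" by simp
  moreover have "(\<Sum>e | e dvd n. \<mu> e) = sum \<mu> (A \<union> B)"
    by (rule sum.mono_neutral_right[OF fin]) (auto simp: A_def B_def moebius_mu_def)
  moreover have "sum \<mu> (A \<union> B) = sum \<mu> A + sum \<mu> B"
    by (rule sum.union_disjoint) (use finAB in \<open>auto simp: A_def B_def\<close>)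
  ultimately show ?thesis by simp
qed

text \<open>
  Put \<open>d = n div k\<close>. Then \<open>d \<ge> k\<close>, so the interval of all \<open>x\<close> with \<open>x div k = d\<close>, which has length
  \<open>k\<close>, ends before \<open>(k + 1) * d\<close>: a larger \<open>j\<close> gives a smaller quotient. If \<open>j < k\<close> the same
  argument applies with the two indices exchanged, since \<open>j\<close> is then below \<open>d\<close> as well.
\<close>

lemma div_eq_div_imp_eq:
  fixes n k j :: nat
  assumes "k > 0" "k\<^sup>2 \<le> n" "n div j = n div k"
  shows "j = k"
proof -
  define d where "d = n div k"
  have kd: "k \<le> d"
    using assms(1,2) by (simp add: d_def less_eq_div_iff_mult_less_eq power2_eq_square)
  have not_greater: False if "0 < i" "i < l" "i \<le> d" "n div i = d" "n div l = d" for i l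
  proof -
    have "n < (d + 1) * i" using that dividend_less_times_div[of i n] by (simp add: algebra_simps)
    also have "\<dots> \<le> (i + 1) * d" using that by (simp add: algebra_simps)
    also have "\<dots> \<le> l * d" using that by (intro mult_right_mono) auto
    also have "\<dots> \<le> n" using times_div_less_eq_dividend[of l n] that by simp
    finally show False by simp
  qed
  have "j > 0" using assms(1,3) kd by (cases j) (auto simp: d_def)
  moreover have "n div k = d" "n div j = d" using assms(3) by (simp_all add: d_def)
  ultimately show ?thesis
    using not_greater[of j k] not_greater[of k j] assms(1) kd
    by (meson less_imp_le linorder_neqE_nat order_trans)
qed

lemma floor_quotient_interval_eq:
  assumes "k > 0" "k\<^sup>2 \<le> n"
  shows "{m. n div k \<preceq>\<^sub>1 m \<and> m \<preceq>\<^sub>1 n} = (\<lambda>l. n div l) ` {l. l dvd k}"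
proof (intro set_eqI iffI)
  fix m assume "m \<in> {m. n div k \<preceq>\<^sub>1 m \<and> m \<preceq>\<^sub>1 n}"
  then obtain i l where "n div k = m div i" and m: "m = n div l"
    unfolding floor_quotient_def by blast
  then have "n div (l * i) = n div k" by (simp add: div_mult2_eq)
  then have "l * i = k" by (rule div_eq_div_imp_eq[OF assms])
  then have "l dvd k" by auto
  then show "m \<in> (\<lambda>l. n div l) ` {l. l dvd k}" using m by blast
next
  fix m assume "m \<in> (\<lambda>l. n div l) ` {l. l dvd k}"
  then obtain l i where m: "m = n div l" and k: "k = l * i" by blast
  have "k \<le> n" using assms(2) by (rule power2_nat_le_imp_le)
  then have "n div k > 0" using assms(1) by (simp add: div_greater_zero_iff)
  moreover have "n div k = m div i" by (simp add: k m div_mult2_eq)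
  moreover from calculation have "m > 0" by (intro gr0I) simp
  moreover have "n > 0" using assms(1) \<open>k \<le> n\<close> by simp
  ultimately show "m \<in> {m. n div k \<preceq>\<^sub>1 m \<and> m \<preceq>\<^sub>1 n}"
    using m assms(1) k unfolding floor_quotient_def by auto
qed

lemma inj_on_div_divisors:
  fixes n k :: nat
  assumes "k > 0" "k\<^sup>2 \<le> n"
  shows "inj_on (\<lambda>l. n div l) {l. l dvd k}"
proof (rule inj_onI)
  fix i j assume "i \<in> {l. l dvd k}" "j \<in> {l. l dvd k}" and eq: "n div i = n div j"
  then have "j > 0" "j \<le> k" using assms(1) by (auto simp: dvd_pos_nat dvd_imp_le)
  have "j\<^sup>2 \<le> n" using \<open>j \<le> k\<close> assms(2) by (meson order_trans power_mono zero_le)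
  show "i = j" using \<open>j > 0\<close> \<open>j\<^sup>2 \<le> n\<close> eq by (rule div_eq_div_imp_eq)
qed

text \<open>
  Induction on \<open>k\<close>, simultaneously for all \<open>n\<close>: a proper lower interval \<open>[n div k, n div l]\<close> with
  \<open>l dvd k\<close> is of the same kind, with \<open>n div l\<close> and \<open>k div l\<close> in place of \<open>n\<close> and \<open>k\<close>.
  The bound passes on, because \<open>(k div l)\<^sup>2 * l \<le> k\<^sup>2 \<le> n\<close>.
\<close>

lemma moebius1_div_eq_moebius_mu:
  assumes "k > 0" "k\<^sup>2 \<le> n"
  shows "\<mu>\<^sub>1 (n div k) n = \<mu> k"
  using assms
proof (induction k arbitrary: n rule: less_induct)
  case (less k)
  have "k \<le> n" using less.prems(2) by (rule power2_nat_le_imp_le)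
  then have pos: "n > 0" "n div k > 0" using less.prems by (auto simp: div_greater_zero_iff)
  show ?case
  proof (cases "k = 1")
    case True
    then show ?thesis
      using is_moebius1_moebius1 pos moebius_mu_1 unfolding is_moebius1_def by simp
  next
    case False
    then have k: "k > 1" using less.prems by simp
    then have ne: "n div k \<noteq> n" using pos by (simp add: div_less_dividend less_imp_neq)
    have fin: "finite {l. l dvd k}" using k by simp
    have step: "\<mu>\<^sub>1 (n div k) (n div l) = \<mu> (k div l)" if l: "l dvd k" "l \<noteq> 1" for l
    proof -
      obtain i where i: "k = l * i" using l(1) by blast
      have l2: "l > 1" "i > 0" using i k l(2) by (auto intro: gr0I simp: nat_neq_iff)
      have "i\<^sup>2 * l \<le> k\<^sup>2" using l2 by (simp add: i power2_eq_square)
      then have "i\<^sup>2 \<le> n div l"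
        using l2 less.prems(2) by (simp add: less_eq_div_iff_mult_less_eq)
      then have "\<mu>\<^sub>1 (n div l div i) (n div l) = \<mu> i" using l2 i by (intro less.IH) auto
      then show ?thesis using i l2 by (simp add: div_mult2_eq)
    qed
    have "0 = (\<Sum>m | n div k \<preceq>\<^sub>1 m \<and> m \<preceq>\<^sub>1 n. \<mu>\<^sub>1 (n div k) m)"
      using is_moebius1_moebius1 pos ne unfolding is_moebius1_def by simp
    also have "\<dots> = (\<Sum>l | l dvd k. \<mu>\<^sub>1 (n div k) (n div l))"
      using less.prems
      by (simp add: floor_quotient_interval_eq sum.reindex inj_on_div_divisors)
    also have "\<dots> = \<mu>\<^sub>1 (n div k) n + (\<Sum>l\<in>{l. l dvd k} - {1}. \<mu>\<^sub>1 (n div k) (n div l))"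
      using fin by (subst sum.remove[of _ 1]) auto
    also have "\<dots> = \<mu>\<^sub>1 (n div k) n + (\<Sum>l\<in>{l. l dvd k} - {1}. \<mu> (k div l))"
      using step by (auto intro!: sum.cong)
    also have "(\<Sum>l\<in>{l. l dvd k} - {1}. \<mu> (k div l)) = (\<Sum>l | l dvd k. \<mu> (k div l)) - \<mu> k"
      using fin by (simp add: sum_diff1)
    also have "(\<Sum>l | l dvd k. \<mu> (k div l)) = (\<Sum>l | l dvd k. \<mu> l)"
      by (rule sum.reindex_bij_witness[of _ "\<lambda>l. k div l" "\<lambda>l. k div l"])
        (use k in \<open>auto simp: div_div_eq_right\<close>)
    also have "\<dots> = 0" using k by (rule sum_moebius_mu_divisors_eq_0)
    finally show ?thesis by simp
  qed
qed

lemma abs_moebius1_le_1: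
  assumes "d > 0" "n > 0" "n \<le> d\<^sup>2"
  shows "\<bar>\<mu>\<^sub>1 d n\<bar> \<le> 1"
proof (cases "d \<preceq>\<^sub>1 n")
  case False
  then show ?thesis using is_moebius1_moebius1 assms unfolding is_moebius1_def by simp
next
  case True
  then obtain k where k: "k > 0" "d = n div k" unfolding floor_quotient_def by blast
  have kd: "k * d \<le> n" using k by simp
  then have "k * d \<le> d * d" using assms(3) by (metis power2_eq_square order_trans)
  then have "k \<le> d" using assms(1) by simp
  then have "k\<^sup>2 \<le> k * d" by (simp add: power2_eq_square)
  then have "k\<^sup>2 \<le> n" using kd by simp
  then show ?thesis
    using k moebius1_div_eq_moebius_mu abs_moebius_mu_le_1 by simp
qed

theorem theorem1p4:
  shows "(\<forall>n k :: nat. n > 0 \<longrightarrow> 1 \<le> k \<longrightarrow> real k \<le> sqrt (real n) \<longrightarrow> \<mu>\<^sub>1 (n div k) n = \<mu> k)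
       \<and> (\<forall>d n :: nat. d > 0 \<longrightarrow> n > 0 \<longrightarrow> real d \<ge> sqrt (real n) \<longrightarrow> \<bar>\<mu>\<^sub>1 d n\<bar> \<le> 1)"
proof (intro conjI allI impI)
  fix n k :: nat
  assume "1 \<le> k" "real k \<le> sqrt (real n)"
  then have "(real k)\<^sup>2 \<le> real n" by (intro sqrt_ge_absD) simp
  then have "k\<^sup>2 \<le> n" by (simp only: of_nat_power[symmetric] of_nat_le_iff)
  then show "\<mu>\<^sub>1 (n div k) n = \<mu> k"
    using \<open>1 \<le> k\<close> by (intro moebius1_div_eq_moebius_mu) auto
next
  fix d n :: nat
  assume "d > 0" "n > 0" "real d \<ge> sqrt (real n)"
  then have "real n \<le> (real d)\<^sup>2" by (intro sqrt_le_D)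
  then have "n \<le> d\<^sup>2" by (simp only: of_nat_power[symmetric] of_nat_le_iff)
  then show "\<bar>\<mu>\<^sub>1 d n\<bar> \<le> 1" using \<open>d > 0\<close> \<open>n > 0\<close> by (intro abs_moebius1_le_1)
qed

end
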